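(* Let $A$ be a bounded, strictly interior, non-degenerate cell (the anchor cell) of the Voronoi tessellation of a finite set of distinct points in $\mathbb R^2$. Let $A$ have $k\ge 3$ edges and neighboring cells $B_1,\dots,B_k$, all bounded, listed in cyclic order around $A$. Suppose that at least two of the ridges separating $A$ from its neighbors are not parallel. Index $A$ by $0$ and $B_j$ by $j$, and read indices in $\{1,\dots,k\}$ cyclically, so that $k+1$ means $1$. For each pair $(i,j)$ in $$\{(0,1),\dots,(0,k)\}\cup\{(1,2),(2,3),\dots,(k-1,k),(k,1)\},$$ let $\mathbf R_{ij}\in\mathbb R^{2\times 2}$ and $\mathbf c_{ij}\in\mathbb R^2$ be the linear reflection and the midpoint associated with the ridge separating cells $i$ and $j$. Consider the linear system of $4k$ scalar equations in the $2(k+1)$ real unknowns $\mathbf z=[\mathbf g_0^{\top},\mathbf g_1^{\top},\dots,\mathbf g_k^{\top}]^{\top}$, with $\mathbf g_j\in\mathbb R^2$, given by $$\mathbf g_j-\mathbf R_{0j}\,\mathbf g_0=(\mathbf I-\mathbf R_{0j})\,\mathbf c_{0j},\qquad j=1,\dots,k,$$ $$\mathbf g_x-\mathbf R_{xy}\,\mathbf g_y=(\mathbf I-\mathbf R_{xy})\,\mathbf c_{xy},\qquad (x,y)=(1,2),(2,3),\dots,(k-1,k),(k,1).$$ Then this system is consistent and has exactly one solution $\mathbf z\in\mathbb R^{2(k+1)}$.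
   Context: The Voronoi tessellation of a finite set $S\subset\mathbb R^2$ of distinct points (generators, or sites) partitions the plane into convex cells. The cell of $P\in S$ is the set of points of the plane at least as close (in Euclidean distance) to $P$ as to every other point of $S$. Two cells are adjacent (neighbors) if they share an edge of positive length. This common edge is called the ridge separating them. It lies on the perpendicular bisector of the segment joining the two generators. A ridge is finite if it is a bounded segment. Its two endpoints are then called its vertices. A cell is strictly interior if its generator does not lie on the boundary of the convex hull of $S$. The anchor cell $A$ is non-degenerate in the sense that exactly three cells meet at each vertex of $A$. Consequently the neighbors of $A$, listed in cyclic order, form a ring: $B_j$ and $B_{j+1}$ (with $B_{k+1}=B_1$) are adjacent and their common ridge has a vertex of $A$ as an endpoint. All ridges used here are finite, because $A$ and the $B_j$ are bounded. For the finite ridge separating cells $i$ and $j$, with distinct vertices $\mathbf p,\mathbf q\in\mathbb R^2$, put $$\mathbf u_{ij}=\frac{\mathbf q-\mathbf p}{\lVert \mathbf q-\mathbf p\rVert},\qquad \mathbf c_{ij}=\frac{\mathbf p+\mathbf q}{2},\qquad \mathbf R_{ij}=2\,\mathbf u_{ij}\mathbf u_{ij}^{\top}-\mathbf I,$$ where $\mathbf I$ is the $2\times2$ identity matrix. Thus $\mathbf R_{ij}$ is the linear reflection across the direction of the ridge. The quantities $\mathbf u_{ij},\mathbf c_{ij},\mathbf R_{ij}$ are data determined by the tessellation, while the $\mathbf g_j$ are the unknowns. *)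

theory Defs
  imports "HOL-Analysis.Analysis"
begin

type_synonym plane = "real ^ 2"

definition voronoi_cell :: "plane set \<Rightarrow> plane \<Rightarrow> plane set" where
  "voronoi_cell S P = {x. \<forall>Q\<in>S. dist x P \<le> dist x Q}"

definition ridge :: "plane set \<Rightarrow> plane \<Rightarrow> plane \<Rightarrow> plane set" where
  "ridge S P Q = voronoi_cell S P \<inter> voronoi_cell S Q"

definition adjacent :: "plane set \<Rightarrow> plane \<Rightarrow> plane \<Rightarrow> bool" where
  "adjacent S P Q \<longleftrightarrow> P \<noteq> Q \<and> (\<exists>a b. a \<noteq> b \<and> closed_segment a b \<subseteq> ridge S P Q)"

definition neighbours :: "plane set \<Rightarrow> plane \<Rightarrow> plane set" where
  "neighbours S P = {Q \<in> S. adjacent S P Q}"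

definition strictly_interior :: "plane set \<Rightarrow> plane \<Rightarrow> bool" where
  "strictly_interior S P \<longleftrightarrow> P \<notin> frontier (convex hull S)"

definition non_degenerate :: "plane set \<Rightarrow> plane \<Rightarrow> bool" where
  "non_degenerate S P \<longleftrightarrow>
     (\<forall>v. v extreme_point_of voronoi_cell S P \<longrightarrow> card {Q \<in> S. v \<in> voronoi_cell S Q} = 3)"

definition polar_dir :: "real \<Rightarrow> plane" where
  "polar_dir t = (\<chi> i. if i = 1 then cos t else sin t)"

text \<open>\<open>B 1, \<dots>, B k\<close> are met in this order during a single turn around \<open>A\<close>, which may start
  at any direction and run in either orientation. The vector \<open>B j - A\<close> is an outer normal
  of the ridge between \<open>A\<close> and \<open>B j\<close>.\<close>

definition cyclically_ordered :: "plane \<Rightarrow> nat \<Rightarrow> (nat \<Rightarrow> plane) \<Rightarrow> bool" where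
  "cyclically_ordered A k B \<longleftrightarrow>
     (\<exists>t :: nat \<Rightarrow> real.
        (strict_mono_on {1..k} t \<and> t k < t 1 + 2 * pi \<or>
         strict_antimono_on {1..k} t \<and> t 1 < t k + 2 * pi) \<and>
        (\<forall>j\<in>{1..k}. B j - A = dist A (B j) *\<^sub>R polar_dir (t j)))"

definition cyc_succ :: "nat \<Rightarrow> nat \<Rightarrow> nat" where
  "cyc_succ k j = (if j = k then 1 else j + 1)"

text \<open>The two vertices of a finite ridge come without an order; one of the two orders is
  chosen. Only the sign of \<open>ridge_dir\<close> depends on that choice, see the lemmas below.\<close>

definition ridge_ends :: "plane set \<Rightarrow> plane \<Rightarrow> plane \<Rightarrow> plane \<times> plane" where
  "ridge_ends S P Q = (SOME (p, q). p \<noteq> q \<and> ridge S P Q = closed_segment p q)"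

definition ridge_dir :: "plane set \<Rightarrow> plane \<Rightarrow> plane \<Rightarrow> plane" where
  "ridge_dir S P Q = (case ridge_ends S P Q of (p, q) \<Rightarrow> (1 / norm (q - p)) *\<^sub>R (q - p))"

definition ridge_mid :: "plane set \<Rightarrow> plane \<Rightarrow> plane \<Rightarrow> plane" where
  "ridge_mid S P Q = (case ridge_ends S P Q of (p, q) \<Rightarrow> midpoint p q)"

definition refl_mat :: "plane \<Rightarrow> real ^ 2 ^ 2" where
  "refl_mat u = 2 *\<^sub>R ((columnvector u :: real ^ 1 ^ 2) ** (rowvector u :: real ^ 2 ^ 1)) - mat 1"

definition ridge_refl :: "plane set \<Rightarrow> plane \<Rightarrow> plane \<Rightarrow> real ^ 2 ^ 2" where
  "ridge_refl S P Q = refl_mat (ridge_dir S P Q)"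

lemma refl_mat_minus: "refl_mat (- u) = refl_mat u"
  by (simp add: refl_mat_def columnvector_def rowvector_def matrix_matrix_mult_def vec_eq_iff)

lemma ridge_ends_cases:
  assumes "p \<noteq> q" and "ridge S P Q = closed_segment p q"
  shows "ridge_ends S P Q = (p, q) \<or> ridge_ends S P Q = (q, p)"
proof -
  obtain a b where ab: "ridge_ends S P Q = (a, b)" by fastforce
  have "case ridge_ends S P Q of (p, q) \<Rightarrow> p \<noteq> q \<and> ridge S P Q = closed_segment p q"
    unfolding ridge_ends_def by (rule someI[of _ "(p, q)"]) (use assms in simp)
  then have "a \<noteq> b" and eq: "closed_segment p q = closed_segment a b"
    using ab assms by auto
  have iff: "x = p \<or> x = q \<longleftrightarrow> x = a \<or> x = b" for x
    using extreme_point_of_segment[of x p q] extreme_point_of_segment[of x a b] eq by simp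
  show ?thesis using ab \<open>a \<noteq> b\<close> iff[of a] iff[of b] by auto
qed

lemma
  assumes "p \<noteq> q" and "ridge S P Q = closed_segment p q"
  shows ridge_mid_eq: "ridge_mid S P Q = midpoint p q"
    and ridge_refl_eq: "ridge_refl S P Q = refl_mat ((1 / norm (q - p)) *\<^sub>R (q - p))"
proof -
  have "(1 / norm (p - q)) *\<^sub>R (p - q) = - ((1 / norm (q - p)) *\<^sub>R (q - p))"
    by (simp add: norm_minus_commute flip: scaleR_minus_right)
  then show "ridge_mid S P Q = midpoint p q"
    and "ridge_refl S P Q = refl_mat ((1 / norm (q - p)) *\<^sub>R (q - p))"
    using ridge_ends_cases[OF assms]
    by (auto simp: ridge_mid_def ridge_refl_def ridge_dir_def midpoint_sym refl_mat_minus)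
qed

end

theory Submission
  imports Defs
begin

text \<open>
  Existence: the generators themselves solve the system. The ridge between two adjacent
  bounded cells is a segment on the perpendicular bisector of the two generators, so the
  affine reflection in its line swaps them; this is \<open>ridge_equation\<close>. The equations around
  the rim require that consecutive neighbours are adjacent too, with a ridge of positive length.

  Adjacency of consecutive neighbours: each end of the ridge between \<open>A\<close> and a neighbour \<open>P\<close> is an
  extreme point of the cell of \<open>A\<close>, hence lies in the cell of exactly one further site \<open>Q\<close>
  (\<open>ridge_end\<close>). Near a point at which exactly three sites are nearest only these three matter,
  and every two of them have a ridge that starts there (\<open>adjacent_if_three_sites\<close>). In
  particular \<open>Q\<close> is a neighbour of \<open>A\<close>. No neighbour of \<open>A\<close> lies
  in a direction strictly between those of \<open>P\<close> and \<open>Q\<close> (\<open>no_neighbour_between\<close>), so \<open>Q\<close> is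
  the cyclic successor of \<open>P\<close> if the end was chosen according to the orientation of the list.

  Uniqueness: let \<open>h\<close> be the difference of two solutions; it satisfies the homogeneous system.
  A linear reflection reverses the sign of the signed area of a parallelogram. At a vertex \<open>v\<close>
  shared by \<open>A\<close>, \<open>P\<close>, \<open>Q\<close> the vectors from \<open>v\<close> to the three generators are mapped to each other
  by the same three reflections as the three values of \<open>h\<close>. An odd number of reflections leads
  around the triangle back to \<open>A\<close>, so the area spanned by \<open>h 0\<close> and \<open>A - v\<close> equals its own
  negative (\<open>cross2_vertex_eq_0\<close>). Hence, if \<open>h 0\<close> is nonzero, all vertices of \<open>A\<close> lie
  on one line through \<open>A\<close>. That line meets the bisector of \<open>A\<close> and a neighbour at most once,
  whereas two consecutive vertices of \<open>A\<close> lie on it, and they are distinct because \<open>k \<ge> 3\<close>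
  (\<open>vertices_in_distinct_directions\<close>). So \<open>h 0 = 0\<close>, and the
  equations between \<open>A\<close> and its neighbours make all of \<open>h\<close> vanish.
\<close>

section \<open>Plane vectors\<close>

definition turn :: "plane \<Rightarrow> plane" where
  "turn z = (\<chi> i. if i = 1 then - z $ 2 else z $ 1)"

definition cross2 :: "plane \<Rightarrow> plane \<Rightarrow> real" where
  "cross2 z w = turn z \<bullet> w"

lemma inner_plane: "(z :: plane) \<bullet> w = z $ 1 * w $ 1 + z $ 2 * w $ 2"
  by (simp add: inner_vec_def UNIV_2)

lemma plane_eq_iff: "(z :: plane) = w \<longleftrightarrow> z $ 1 = w $ 1 \<and> z $ 2 = w $ 2"
  by (simp add: vec_eq_iff forall_2)

lemma turn_nth [simp]: "turn z $ 1 = - z $ 2" "turn z $ 2 = z $ 1"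
  by (simp_all add: turn_def)

lemma inner_turn_self [simp]: "turn z \<bullet> z = 0"
  by (simp add: inner_plane)

lemma turn_eq_0_iff [simp]: "turn z = 0 \<longleftrightarrow> z = 0"
  by (auto simp: plane_eq_iff)

lemma cross2_eq: "cross2 z w = z $ 1 * w $ 2 - z $ 2 * w $ 1"
  by (simp add: cross2_def inner_plane)

lemma cross2_polar: "cross2 (a *\<^sub>R polar_dir s) (b *\<^sub>R polar_dir t) = a * b * sin (t - s)"
  by (simp add: cross2_eq polar_dir_def sin_diff algebra_simps)

lemma eq_0_if_inner_turn:
  assumes "n \<noteq> 0" "w \<bullet> n = 0" "w \<bullet> turn n = 0"
  shows "w = 0"
proof -
  have "(n \<bullet> n) * w $ 1 = (w \<bullet> n) * n $ 1 - (w \<bullet> turn n) * n $ 2"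
    "(n \<bullet> n) * w $ 2 = (w \<bullet> n) * n $ 2 + (w \<bullet> turn n) * n $ 1"
    by (simp_all add: inner_plane algebra_simps)
  with assms have "(n \<bullet> n) * w $ 1 = 0" "(n \<bullet> n) * w $ 2 = 0" by simp_all
  moreover have "n \<bullet> n \<noteq> 0" using assms(1) by simp
  ultimately show ?thesis by (simp del: inner_eq_zero_iff add: plane_eq_iff)
qed

lemma parallel_if_cross2_eq_0:
  assumes "cross2 h w = 0" "h \<noteq> 0"
  obtains c where "w = c *\<^sub>R h"
proof
  have "w - ((w \<bullet> h) / (h \<bullet> h)) *\<^sub>R h = 0"
  proof (rule eq_0_if_inner_turn[OF assms(2)])
    show "(w - ((w \<bullet> h) / (h \<bullet> h)) *\<^sub>R h) \<bullet> h = 0"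
      using assms(2) by (simp add: inner_diff_left)
    show "(w - ((w \<bullet> h) / (h \<bullet> h)) *\<^sub>R h) \<bullet> turn h = 0"
      using assms(1)
      by (simp add: cross2_def inner_diff_right inner_commute[of _ "turn h"])
  qed
  then show "w = ((w \<bullet> h) / (h \<bullet> h)) *\<^sub>R h" by simp
qed

lemma multiple_of_turn:
  assumes "n \<bullet> w = 0" "n \<noteq> 0"
  obtains c where "w = c *\<^sub>R turn n"
proof (rule parallel_if_cross2_eq_0)
  have "cross2 (turn n) w = - (n \<bullet> w)" by (simp add: cross2_eq inner_plane)
  then show "cross2 (turn n) w = 0" using assms(1) by simp
  show "turn n \<noteq> 0" using assms(2) by simp
qed

text \<open>Cramer's rule, multiplied out: if \<open>l\<close> points strictly between \<open>p\<close> and \<open>q\<close>, all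
  three coefficients have the same sign, and \<open>l\<close> is a positive combination of \<open>p\<close> and \<open>q\<close>.\<close>

lemma cross2_expand: "cross2 p q *\<^sub>R l = cross2 l q *\<^sub>R p + cross2 p l *\<^sub>R q"
  by (simp add: cross2_eq plane_eq_iff algebra_simps)

lemma refl_mat_apply: "refl_mat u *v z = (2 * (u \<bullet> z)) *\<^sub>R u - z"
  by (simp add: refl_mat_def columnvector_def rowvector_def matrix_matrix_mult_def
      matrix_vector_mult_def plane_eq_iff inner_plane sum_2 mat_def algebra_simps)

lemma cross2_refl_mat:
  assumes "norm u = 1"
  shows "cross2 (refl_mat u *v z) (refl_mat u *v w) = - cross2 z w"
proof -
  have u: "u $ 1 * u $ 1 + u $ 2 * u $ 2 = 1"
    using assms by (simp add: norm_eq_1 inner_plane)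
  show ?thesis
    unfolding cross2_eq refl_mat_apply inner_plane using u by simp algebra
qed

text \<open>Both \<open>u\<close> and \<open>p + q\<close> are orthogonal to \<open>q - p\<close>, hence parallel to each other in the plane, so
  the reflection fixes \<open>p + q\<close>, while it negates \<open>q - p\<close>.\<close>

lemma refl_mat_swaps:
  assumes "norm u = 1" "u \<bullet> (q - p) = 0" "p \<noteq> q" "norm p = norm q"
  shows "refl_mat u *v p = q"
proof -
  have "(q - p) \<bullet> u = 0" using assms(2) by (simp only: inner_commute)
  then obtain c where c: "u = c *\<^sub>R turn (q - p)"
    by (rule multiple_of_turn) (use assms(3) in simp)
  have "(q - p) \<bullet> (p + q) = 0"
    using assms(4) by (simp add: norm_eq inner_diff_left inner_add_right inner_commute[of p q])
  then obtain d where d: "p + q = d *\<^sub>R turn (q - p)"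
    by (rule multiple_of_turn) (use assms(3) in simp)
  have "c \<noteq> 0" using c assms(1) by auto
  then have s: "p + q = (d / c) *\<^sub>R u" using c d by simp
  have "2 * (u \<bullet> p) = u \<bullet> (p + q)"
    using assms(2) by (simp add: inner_diff_right inner_add_right)
  also have "\<dots> = d / c" unfolding s using assms(1) by (simp add: norm_eq_1)
  finally have "refl_mat u *v p = p + q - p" unfolding s by (simp add: refl_mat_apply)
  then show ?thesis by simp
qed

section \<open>Voronoi cells and ridges\<close>

lemma dist_le_iff_inner:
  fixes x P Q :: plane
  shows "dist x P \<le> dist x Q \<longleftrightarrow> 2 * ((Q - P) \<bullet> x) \<le> Q \<bullet> Q - P \<bullet> P"
  by (simp add: dist_norm norm_le inner_diff inner_commute algebra_simps)

lemma dist_eq_iff_inner: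
  fixes x P Q :: plane
  shows "dist x P = dist x Q \<longleftrightarrow> 2 * ((Q - P) \<bullet> x) = Q \<bullet> Q - P \<bullet> P"
  using dist_le_iff_inner[of x P Q] dist_le_iff_inner[of x Q P]
  by (auto simp: inner_diff_left)

text \<open>The quadratic terms in \<open>w\<close> cancel, so a comparison of distances from a point that starts on
  the bisector depends on the direction of the move only.\<close>

lemma dist_le_add_iff:
  fixes v w P Q :: plane
  assumes "dist v P = dist v Q"
  shows "dist (v + w) P \<le> dist (v + w) Q \<longleftrightarrow> (Q - P) \<bullet> w \<le> 0"
  using assms by (simp add: dist_le_iff_inner dist_eq_iff_inner inner_add_right)

lemma voronoi_cell_eq_halfspaces:
  "voronoi_cell S P = (\<Inter>Q\<in>S. {x. (2 *\<^sub>R (Q - P)) \<bullet> x \<le> Q \<bullet> Q - P \<bullet> P})"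
  by (auto simp: voronoi_cell_def dist_le_iff_inner)

lemma convex_voronoi_cell: "convex (voronoi_cell S P)"
  unfolding voronoi_cell_eq_halfspaces by (intro convex_INT convex_halfspace_le)

lemma closed_voronoi_cell: "closed (voronoi_cell S P)"
  unfolding voronoi_cell_eq_halfspaces by (intro closed_INT ballI closed_halfspace_le)

lemma convex_ridge: "convex (ridge S P Q)"
  by (simp add: ridge_def convex_Int convex_voronoi_cell)

lemma compact_ridge: "bounded (voronoi_cell S P) \<Longrightarrow> compact (ridge S P Q)"
  by (simp add: ridge_def compact_eq_bounded_closed closed_Int closed_voronoi_cell bounded_Int)

lemma ridge_equidistant:
  assumes "P \<in> S" "Q \<in> S" "x \<in> ridge S P Q"
  shows "dist x P = dist x Q"
  using assms by (auto simp: ridge_def voronoi_cell_def intro: antisym)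

lemma mem_ridge_iff:
  assumes "P \<in> S" "Q \<in> S"
  shows "x \<in> ridge S P Q \<longleftrightarrow> x \<in> voronoi_cell S P \<and> dist x P = dist x Q"
  using assms by (auto simp: ridge_def voronoi_cell_def intro: antisym)

lemma inner_ridge_diff:
  assumes "P \<in> S" "Q \<in> S" "x \<in> ridge S P Q" "y \<in> ridge S P Q"
  shows "(Q - P) \<bullet> (y - x) = 0"
  using ridge_equidistant[OF assms(1,2,3)] ridge_equidistant[OF assms(1,2,4)]
  by (simp add: dist_eq_iff_inner inner_diff_right)

lemma ridge_eq_segment:
  assumes "P \<in> S" "Q \<in> S" "bounded (voronoi_cell S P)" "adjacent S P Q"
  obtains p q where "p \<noteq> q" "ridge S P Q = closed_segment p q"
proof -
  have "P \<noteq> Q" using assms(4) by (simp add: adjacent_def)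
  obtain a b where ab: "a \<noteq> b" "closed_segment a b \<subseteq> ridge S P Q"
    using assms(4) by (auto simp: adjacent_def)
  have line: "collinear (ridge S P Q)"
    unfolding collinear_def
  proof (rule exI[of _ "turn (Q - P)"], intro ballI)
    fix x y assume xy: "x \<in> ridge S P Q" "y \<in> ridge S P Q"
    have "Q - P \<noteq> 0" using \<open>P \<noteq> Q\<close> by simp
    with inner_ridge_diff[OF assms(1,2) xy(2,1)]
    obtain c where "x - y = c *\<^sub>R turn (Q - P)" by (rule multiple_of_turn)
    then show "\<exists>c. x - y = c *\<^sub>R turn (Q - P)" ..
  qed
  have "a \<in> ridge S P Q" using ab(2) by (rule subsetD) simp
  then have "ridge S P Q \<noteq> {}" by (rule ex_in_conv[THEN iffD1, OF exI])
  then obtain p q where pq: "ridge S P Q = closed_segment p q"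
    by (rule compact_convex_collinear_segment[OF _ compact_ridge[OF assms(3)] convex_ridge line])
  have "p \<noteq> q"
  proof
    assume "p = q"
    then have "closed_segment a b \<subseteq> {q}" using ab(2) pq by simp
    then have "a \<in> {q}" "b \<in> {q}" using ends_in_segment by blast+
    with ab(1) show False by simp
  qed
  then show ?thesis using pq by (rule that)
qed

text \<open>The chosen endpoints of the ridge are used only here. Everything later follows from these
  facts: the ridge midpoint is merely some point \<open>v\<close> of the ridge, and seen from any such point
  the linear reflection exchanges the two generators.\<close>

lemma
  assumes "P \<in> S" "Q \<in> S" "bounded (voronoi_cell S P)" "adjacent S P Q"
  shows ridge_mid_in_ridge: "ridge_mid S P Q \<in> ridge S P Q"
    and cross2_ridge_refl:
      "\<And>z w. cross2 (ridge_refl S P Q *v z) (ridge_refl S P Q *v w) = - cross2 z w"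
    and ridge_refl_swaps: "\<And>v. v \<in> ridge S P Q \<Longrightarrow> ridge_refl S P Q *v (P - v) = Q - v"
      "\<And>v. v \<in> ridge S P Q \<Longrightarrow> ridge_refl S P Q *v (Q - v) = P - v"
proof -
  obtain p q where pq: "p \<noteq> q" "ridge S P Q = closed_segment p q"
    using ridge_eq_segment[OF assms] .
  define u where "u = (1 / norm (q - p)) *\<^sub>R (q - p)"
  have R: "ridge_refl S P Q = refl_mat u"
    using ridge_refl_eq[OF pq] by (simp add: u_def)
  have u1: "norm u = 1" using pq(1) by (simp add: u_def)
  show "ridge_mid S P Q \<in> ridge S P Q"
    using ridge_mid_eq[OF pq] pq(2) by simp
  show "cross2 (ridge_refl S P Q *v z) (ridge_refl S P Q *v w) = - cross2 z w" for z w
    using cross2_refl_mat[OF u1] R by simp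
  have "(Q - P) \<bullet> (q - p) = 0"
    using inner_ridge_diff[OF assms(1,2)] pq(2) by simp
  then have perp: "u \<bullet> (Q - P) = 0" by (simp add: u_def inner_commute)
  have "P \<noteq> Q" using assms(4) by (simp add: adjacent_def)
  fix v assume v: "v \<in> ridge S P Q"
  have len: "norm (P - v) = norm (Q - v)"
    using ridge_equidistant[OF assms(1,2) v] by (simp only: dist_norm norm_minus_commute)
  show "ridge_refl S P Q *v (P - v) = Q - v"
    unfolding R
  proof (rule refl_mat_swaps[OF u1])
    show "u \<bullet> (Q - v - (P - v)) = 0" using perp by simp
    show "norm (P - v) = norm (Q - v)" by (fact len)
  qed (use \<open>P \<noteq> Q\<close> in simp)
  show "ridge_refl S P Q *v (Q - v) = P - v"
    unfolding R
  proof (rule refl_mat_swaps[OF u1])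
    show "u \<bullet> (P - v - (Q - v)) = 0" using perp by (simp add: inner_diff_right)
    show "norm (Q - v) = norm (P - v)" by (simp only: len)
  qed (use \<open>P \<noteq> Q\<close> in simp)
qed

lemma ridge_equation:
  assumes "P \<in> S" "Q \<in> S" "bounded (voronoi_cell S P)" "adjacent S P Q"
  shows "P - ridge_refl S P Q *v Q = (mat 1 - ridge_refl S P Q) *v ridge_mid S P Q"
    and "Q - ridge_refl S P Q *v P = (mat 1 - ridge_refl S P Q) *v ridge_mid S P Q"
proof -
  have rearrange: "x - a = m - b" if "a - b = x - m" for a b m x :: plane
  proof -
    have "x - a = (x - m) + (m - a)" by simp
    also have "\<dots> = (a - b) + (m - a)" by (simp only: that)
    also have "\<dots> = m - b" by simp
    finally show ?thesis .
  qed
  note swaps = ridge_refl_swaps[OF assms ridge_mid_in_ridge[OF assms]]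
  show "P - ridge_refl S P Q *v Q = (mat 1 - ridge_refl S P Q) *v ridge_mid S P Q"
    using rearrange[OF swaps(2)[unfolded matrix_vector_mult_diff_distrib]]
    by (simp add: matrix_vector_mult_diff_rdistrib)
  show "Q - ridge_refl S P Q *v P = (mat 1 - ridge_refl S P Q) *v ridge_mid S P Q"
    using rearrange[OF swaps(1)[unfolded matrix_vector_mult_diff_distrib]]
    by (simp add: matrix_vector_mult_diff_rdistrib)
qed

section \<open>Vertices where three cells meet\<close>

definition sites_at :: "plane set \<Rightarrow> plane \<Rightarrow> plane set" where
  "sites_at S v = {R \<in> S. v \<in> voronoi_cell S R}"

lemma sites_at_equidistant:
  "P \<in> sites_at S v \<Longrightarrow> Q \<in> sites_at S v \<Longrightarrow> dist v P = dist v Q"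
  by (auto simp: sites_at_def voronoi_cell_def intro: antisym)

lemma dist_less_if_not_site:
  assumes "P \<in> sites_at S v" "R \<in> S - sites_at S v"
  shows "dist v P < dist v R"
proof -
  obtain Q where "Q \<in> S" "dist v Q < dist v R"
    using assms(2) by (auto simp: sites_at_def voronoi_cell_def not_le)
  moreover have "dist v P \<le> dist v Q"
    using assms(1) \<open>Q \<in> S\<close> by (simp add: sites_at_def voronoi_cell_def)
  ultimately show ?thesis by simp
qed

text \<open>The sites that are not nearest at \<open>v\<close> are farther away by a positive margin, because there are
  finitely many of them. A short step therefore has to be compared with the nearest sites only.\<close>

lemma step_stays_in_cell:
  assumes "finite S" "P \<in> sites_at S v"
    and "\<And>R. R \<in> sites_at S v \<Longrightarrow> (R - P) \<bullet> w \<le> 0"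
  obtains e where "e > 0" "v + e *\<^sub>R w \<in> voronoi_cell S P"
proof -
  have "\<forall>\<^sub>F e in at_right 0. \<forall>R\<in>S - sites_at S v. dist (v + e *\<^sub>R w) P < dist (v + e *\<^sub>R w) R"
  proof (rule eventually_ball_finite)
    show "finite (S - sites_at S v)" using assms(1) by simp
    show "\<forall>R\<in>S - sites_at S v. \<forall>\<^sub>F e in at_right 0. dist (v + e *\<^sub>R w) P < dist (v + e *\<^sub>R w) R"
    proof
      fix R assume R: "R \<in> S - sites_at S v"
      have "((\<lambda>e::real. dist (v + e *\<^sub>R w) R - dist (v + e *\<^sub>R w) P) \<longlongrightarrow> dist (v + 0 *\<^sub>R w) R - dist (v + 0 *\<^sub>R w) P) (at_right 0)"
        by (intro tendsto_intros)
      moreover have "0 < dist (v + 0 *\<^sub>R w) R - dist (v + 0 *\<^sub>R w) P"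
        using dist_less_if_not_site[OF assms(2) R] by simp
      ultimately have "\<forall>\<^sub>F e in at_right (0::real). 0 < dist (v + e *\<^sub>R w) R - dist (v + e *\<^sub>R w) P"
        by (rule order_tendstoD(1))
      then show "\<forall>\<^sub>F e in at_right 0. dist (v + e *\<^sub>R w) P < dist (v + e *\<^sub>R w) R" by simp
    qed
  qed
  then have "\<forall>\<^sub>F e in at_right 0. e > 0 \<and> (\<forall>R\<in>S - sites_at S v. dist (v + e *\<^sub>R w) P < dist (v + e *\<^sub>R w) R)"
    using eventually_at_right_less[of "0::real"] by eventually_elim auto
  then obtain e where e: "e > 0" "\<forall>R\<in>S - sites_at S v. dist (v + e *\<^sub>R w) P < dist (v + e *\<^sub>R w) R"
    using eventually_happens'[OF trivial_limit_at_right_real] by blast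
  have "dist (v + e *\<^sub>R w) P \<le> dist (v + e *\<^sub>R w) R" if "R \<in> S" for R
  proof (cases "R \<in> sites_at S v")
    case True
    then show ?thesis
      using assms(3)[OF True] e(1) dist_le_add_iff[OF sites_at_equidistant[OF assms(2) True]]
      by (simp add: mult_le_0_iff)
  next
    case False
    then show ?thesis using e(2) that by (simp add: less_imp_le)
  qed
  then show ?thesis using e(1) that by (auto simp: voronoi_cell_def)
qed

text \<open>Move from \<open>v\<close> along the bisector of \<open>P\<close> and \<open>Q\<close>, in the sense that does not favour the third
  site \<open>C\<close> over \<open>P\<close>.\<close>

lemma adjacent_if_three_sites:
  assumes "finite S" "sites_at S v = {C, P, Q}" "P \<noteq> Q"
  shows "adjacent S P Q"
proof -
  define w where "w = (if turn (Q - P) \<bullet> (C - P) \<le> 0 then turn (Q - P) else - turn (Q - P))"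
  have w0: "w \<noteq> 0" using assms(3) by (simp add: w_def)
  have wC: "(C - P) \<bullet> w \<le> 0" by (auto simp: w_def inner_commute)
  have wQ: "(Q - P) \<bullet> w = 0"
    using inner_turn_self[of "Q - P"] by (auto simp: w_def inner_commute)
  have P: "P \<in> sites_at S v" and Q: "Q \<in> sites_at S v" using assms(2) by auto
  have "(R - P) \<bullet> w \<le> 0" if "R \<in> sites_at S v" for R
    using that wC wQ by (auto simp: assms(2))
  then obtain e where e: "e > 0" "v + e *\<^sub>R w \<in> voronoi_cell S P"
    using step_stays_in_cell[OF assms(1) P] by blast
  have PQ: "P \<in> S" "Q \<in> S" using P Q by (auto simp: sites_at_def)
  have "dist (v + e *\<^sub>R w) P = dist (v + e *\<^sub>R w) Q"
    using sites_at_equidistant[OF P Q] wQ by (simp add: dist_eq_iff_inner inner_add_right)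
  then have "v + e *\<^sub>R w \<in> ridge S P Q" using e(2) PQ by (simp add: mem_ridge_iff)
  moreover have "v \<in> ridge S P Q" using P Q by (auto simp: sites_at_def ridge_def)
  ultimately have "closed_segment v (v + e *\<^sub>R w) \<subseteq> ridge S P Q"
    using convex_ridge by (simp add: closed_segment_subset)
  moreover have "v \<noteq> v + e *\<^sub>R w" using e(1) w0 by simp
  ultimately show ?thesis using assms(3) unfolding adjacent_def by blast
qed

text \<open>The ridge has one end in the direction of \<open>turn (P - A)\<close> and one in the opposite direction; the
  sign of \<open>s\<close> selects the end, and then the side of \<open>P\<close> on which \<open>Q\<close> is seen from \<open>A\<close>: the
  third cell is the obstacle that stops the ridge there.\<close>

lemma ridge_end:
  assumes "finite S" "A \<in> S" "P \<in> S" "bounded (voronoi_cell S A)" "non_degenerate S A"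
    and "adjacent S A P" "s \<noteq> 0"
  obtains v Q where "sites_at S v = {A, P, Q}" "Q \<noteq> A" "Q \<noteq> P" "s * cross2 (P - A) (Q - A) > 0"
proof -
  define d where "d = s *\<^sub>R turn (P - A)"
  have "A \<noteq> P" using assms(6) by (simp add: adjacent_def)
  have "ridge S A P \<noteq> {}" using assms(6) unfolding adjacent_def by force
  moreover have "continuous_on (ridge S A P) (\<lambda>x. d \<bullet> x)" by (intro continuous_intros)
  ultimately obtain v where v: "v \<in> ridge S A P" "\<And>x. x \<in> ridge S A P \<Longrightarrow> d \<bullet> x \<le> d \<bullet> v"
    using continuous_attains_sup[OF compact_ridge[OF assms(4)]] by blast
  have vA: "v \<in> voronoi_cell S A" and vP: "v \<in> voronoi_cell S P"
    using v(1) by (auto simp: ridge_def)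
  have dv: "dist v A = dist v P" using ridge_equidistant[OF assms(2,3) v(1)] .
  have "v extreme_point_of voronoi_cell S A"
    unfolding extreme_point_of_def
  proof (intro conjI ballI notI)
    fix a b assume ab: "a \<in> voronoi_cell S A" "b \<in> voronoi_cell S A" "v \<in> open_segment a b"
    obtain t where t: "0 < t" "t < 1" and vt: "v = (1 - t) *\<^sub>R a + t *\<^sub>R b" and "a \<noteq> b"
      using ab(3) by (auto simp: in_segment)
    \<comment> \<open>\<open>f\<close> is affine, is nonpositive on the cell, and vanishes exactly on the bisector.\<close>
    define f where "f x = 2 * ((P - A) \<bullet> x) - (P \<bullet> P - A \<bullet> A)" for x
    have f: "f a \<le> 0" "f b \<le> 0"
      using ab(1,2) assms(3) by (auto simp: f_def voronoi_cell_def dist_le_iff_inner)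
    have "0 = f v" using dv by (simp add: f_def dist_eq_iff_inner)
    also have "\<dots> = (1 - t) * f a + t * f b"
      unfolding f_def vt by (simp add: inner_add_right algebra_simps)
    finally have sum: "(1 - t) * f a + t * f b = 0" by simp
    have "(1 - t) * f a \<le> 0" "t * f b \<le> 0"
      using f t by (simp_all add: mult_le_0_iff)
    with sum have "(1 - t) * f a = 0" "t * f b = 0" by linarith+
    with t have "f a = 0" "f b = 0" by auto
    then have r: "a \<in> ridge S A P" "b \<in> ridge S A P"
      using ab(1,2) assms(2,3) by (auto simp: mem_ridge_iff f_def dist_eq_iff_inner)
    have "d \<bullet> v = (1 - t) * (d \<bullet> a) + t * (d \<bullet> b)"
      unfolding vt by (simp add: inner_add_right)
    then have "(1 - t) * (d \<bullet> v - d \<bullet> a) + t * (d \<bullet> v - d \<bullet> b) = 0"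
      by (simp add: algebra_simps)
    moreover have "(1 - t) * (d \<bullet> v - d \<bullet> a) \<ge> 0" "t * (d \<bullet> v - d \<bullet> b) \<ge> 0"
      using v(2)[OF r(1)] v(2)[OF r(2)] t by simp_all
    ultimately have "(1 - t) * (d \<bullet> v - d \<bullet> a) = 0" "t * (d \<bullet> v - d \<bullet> b) = 0" by linarith+
    with t have "d \<bullet> a = d \<bullet> b" by auto
    then have "(b - a) \<bullet> turn (P - A) = 0"
      using assms(7) by (simp add: d_def inner_diff_left inner_commute)
    moreover have "(b - a) \<bullet> (P - A) = 0"
      using inner_ridge_diff[OF assms(2,3) r] by (simp add: inner_commute)
    ultimately have "b - a = 0" using eq_0_if_inner_turn \<open>A \<noteq> P\<close> by (metis eq_iff_diff_eq_0)
    with \<open>a \<noteq> b\<close> show False by simp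
  qed (fact vA)
  then have card: "card (sites_at S v) = 3"
    using assms(5) by (simp add: non_degenerate_def sites_at_def)
  have AP: "A \<in> sites_at S v" "P \<in> sites_at S v"
    using vA vP assms(2,3) by (auto simp: sites_at_def)
  have fin: "finite (sites_at S v)" using assms(1) by (simp add: sites_at_def)
  have "card (sites_at S v - {A, P}) = 1"
    using card AP fin \<open>A \<noteq> P\<close> by (simp add: card_Diff_subset)
  then obtain Q where "sites_at S v - {A, P} = {Q}" using card_1_singletonE by blast
  then have Q: "sites_at S v = {A, P, Q}" "Q \<noteq> A" "Q \<noteq> P" using AP by auto
  \<comment> \<open>Otherwise the ridge would continue beyond \<open>v\<close>.\<close>
  have "(Q - A) \<bullet> d > 0"
  proof (rule ccontr)
    assume neg: "\<not> (Q - A) \<bullet> d > 0"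
    have Pd: "(P - A) \<bullet> d = 0" using inner_turn_self[of "P - A"] by (simp add: d_def inner_commute)
    have "(R - A) \<bullet> d \<le> 0" if "R \<in> sites_at S v" for R
      using that neg Pd by (auto simp: Q(1))
    then obtain e where e: "e > 0" "v + e *\<^sub>R d \<in> voronoi_cell S A"
      using step_stays_in_cell[OF assms(1) AP(1)] by blast
    have "dist (v + e *\<^sub>R d) A = dist (v + e *\<^sub>R d) P"
      using dv Pd by (simp add: dist_eq_iff_inner inner_add_right)
    then have "v + e *\<^sub>R d \<in> ridge S A P" using e(2) assms(2,3) by (simp add: mem_ridge_iff)
    from v(2)[OF this] have "e * (d \<bullet> d) \<le> 0" by (simp add: inner_add_right)
    then have "d \<bullet> d \<le> 0" using e(1) by (simp add: mult_le_0_iff)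
    then have "d = 0" by (metis inner_ge_zero inner_eq_zero_iff order_antisym)
    then show False using assms(7) \<open>A \<noteq> P\<close> by (simp add: d_def)
  qed
  then have "s * cross2 (P - A) (Q - A) > 0"
    by (simp add: d_def cross2_def inner_commute)
  with Q show ?thesis using that by blast
qed

text \<open>Suppose that \<open>L - A\<close> is a positive combination of \<open>P - A\<close> and \<open>Q - A\<close>. Over the cell of \<open>A\<close>,
  the inner products with \<open>P - A\<close> and \<open>Q - A\<close> are both maximal at \<open>v\<close>, hence so is that with
  \<open>L - A\<close>. Its maximum is attained on the ridge towards \<open>L\<close>, so \<open>v\<close> would be a point of that
  ridge, and \<open>L\<close> a fourth site at \<open>v\<close>.\<close>

lemma no_neighbour_between:
  assumes "sites_at S v = {A, P, Q}" "A \<in> S" "L \<in> S" "adjacent S A L"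
    and "s * cross2 (P - A) (Q - A) > 0"
  shows "\<not> (s * cross2 (P - A) (L - A) > 0 \<and> s * cross2 (L - A) (Q - A) > 0)"
proof
  assume L: "s * cross2 (P - A) (L - A) > 0 \<and> s * cross2 (L - A) (Q - A) > 0"
  have "L \<notin> sites_at S v"
  proof
    assume "L \<in> sites_at S v"
    then show False using L by (auto simp: assms(1) cross2_eq)
  qed
  then have "dist v A < dist v L"
    using dist_less_if_not_site[of A S v L] assms(1,3) by auto
  then have vL: "2 * ((L - A) \<bullet> v) < L \<bullet> L - A \<bullet> A"
    using dist_le_iff_inner[of v L A] by (simp add: inner_diff_left)
  obtain x where x: "x \<in> ridge S A L" using assms(4) unfolding adjacent_def by force
  have xL: "2 * ((L - A) \<bullet> x) = L \<bullet> L - A \<bullet> A"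
    using ridge_equidistant[OF assms(2,3) x] by (simp add: dist_eq_iff_inner)
  have le: "(R - A) \<bullet> x \<le> (R - A) \<bullet> v" if "R \<in> {P, Q}" for R
  proof -
    have R: "R \<in> sites_at S v" using that assms(1) by auto
    have "dist v A = dist v R"
      using sites_at_equidistant[OF _ R, of A] assms(1) by simp
    moreover have "dist x A \<le> dist x R"
      using x R by (simp add: ridge_def voronoi_cell_def sites_at_def)
    ultimately show ?thesis by (simp add: dist_eq_iff_inner dist_le_iff_inner)
  qed
  have ex: "(s * cross2 (P - A) (Q - A)) * ((L - A) \<bullet> y)
      = (s * cross2 (L - A) (Q - A)) * ((P - A) \<bullet> y) + (s * cross2 (P - A) (L - A)) * ((Q - A) \<bullet> y)" for y
    using arg_cong[OF cross2_expand[of "P - A" "Q - A" "L - A"], of "\<lambda>z. s * (z \<bullet> y)"]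
    by (simp add: inner_add_left algebra_simps)
  have "(s * cross2 (P - A) (Q - A)) * ((L - A) \<bullet> x) \<le> (s * cross2 (P - A) (Q - A)) * ((L - A) \<bullet> v)"
    unfolding ex using L le by (intro add_mono mult_left_mono) auto
  then have "(L - A) \<bullet> x \<le> (L - A) \<bullet> v" using assms(5) by (rule mult_left_le_imp_le)
  with vL xL show False by simp
qed

section \<open>Cyclic order\<close>

lemma sin_pos_iff_interval:
  assumes "0 < x" "x < 2 * pi"
  shows "sin x > 0 \<longleftrightarrow> x < pi"
  using assms sin_gt_zero[of x] sin_le_zero[of x] by fastforce

text \<open>The hypotheses on sines say that \<open>t m\<close> follows \<open>t j\<close> within half a turn and that no angle of
  the list lies strictly between. If \<open>m\<close> were not the successor, then the angle with index
  \<open>j + 1\<close>, or \<open>k\<close> or \<open>1\<close> when the passage wraps around, would lie between.\<close>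

lemma next_angle_is_cyc_succ:
  assumes mono: "strict_mono_on {1..k} t" and wrap: "t k < t 1 + 2 * pi"
    and j: "j \<in> {1..k}" and m: "m \<in> {1..k}" and pos: "sin (t m - t j) > 0"
    and gap: "\<And>l. l \<in> {1..k} \<Longrightarrow> \<not> (sin (t l - t j) > 0 \<and> sin (t m - t l) > 0)"
  shows "m = cyc_succ k j"
proof -
  have lt: "t a < t b" if "a < b" "1 \<le> a" "b \<le> k" for a b
    using mono that by (auto simp: strict_mono_on_def)
  have le: "t a \<le> t b" if "a \<le> b" "1 \<le> a" "b \<le> k" for a b
    using lt[of a b] that by (cases "a = b") auto
  have b1: "t 1 \<le> t i" "t i \<le> t k" if "i \<in> {1..k}" for i
    using le[of 1 i] le[of i k] that by auto
  consider "m = j" | "j < m" | "m < j" by linarith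
  then show ?thesis
  proof cases
    case 1
    then show ?thesis using pos by simp
  next
    case 2
    then have mj: "t m - t j < pi"
      using pos sin_pos_iff_interval[of "t m - t j"] lt[of j m] b1[OF j] b1[OF m] wrap j m by auto
    have "m = j + 1"
    proof (rule ccontr)
      assume "m \<noteq> j + 1"
      then have "t j < t (j + 1)" "t (j + 1) < t m" using lt 2 j m by auto
      then have "sin (t (j + 1) - t j) > 0" "sin (t m - t (j + 1)) > 0"
        using mj by (auto intro!: sin_gt_zero)
      then show False using gap[of "j + 1"] 2 j m by auto
    qed
    then show ?thesis using 2 m by (auto simp: cyc_succ_def)
  next
    case 3
    have mj: "t m - t j + 2 * pi < pi"
      using pos sin_pos_iff_interval[of "t m - t j + 2 * pi"] lt[of m j] 3 b1[OF j] b1[OF m] wrap j m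
      by (simp add: sin_add)
    have "j = k"
    proof (rule ccontr)
      assume "j \<noteq> k"
      then have "t j < t k" using lt j by auto
      then have "sin (t k - t j) > 0" "sin (t m - t k + 2 * pi) > 0"
        using mj b1[OF m] wrap by (auto intro!: sin_gt_zero simp del: sin_periodic)
      then show False using gap[of k] j by auto
    qed
    moreover have "m = 1"
    proof (rule ccontr)
      assume "m \<noteq> 1"
      then have "t 1 < t m" using lt m by auto
      then have "sin (t 1 - t j + 2 * pi) > 0" "sin (t m - t 1) > 0"
        using mj b1[OF j] wrap by (auto intro!: sin_gt_zero simp del: sin_periodic)
      then show False using gap[of 1] j by auto
    qed
    ultimately show ?thesis by (simp add: cyc_succ_def)
  qed
qed

text \<open>The sign \<open>s\<close> is the orientation of the list. It turns a clockwise order of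
  angles into a counterclockwise one, so that both orientations are treated together.\<close>

lemma cyclically_ordered_succ:
  assumes "cyclically_ordered A k B" "\<And>j. j \<in> {1..k} \<Longrightarrow> B j \<noteq> A"
  obtains s :: real where "s \<noteq> 0"
    "\<And>j m. \<lbrakk>j \<in> {1..k}; m \<in> {1..k}; s * cross2 (B j - A) (B m - A) > 0;
      \<And>l. l \<in> {1..k} \<Longrightarrow>
        \<not> (s * cross2 (B j - A) (B l - A) > 0 \<and> s * cross2 (B l - A) (B m - A) > 0)\<rbrakk>
      \<Longrightarrow> m = cyc_succ k j"
proof -
  obtain t :: "nat \<Rightarrow> real" where
    t: "strict_mono_on {1..k} t \<and> t k < t 1 + 2 * pi \<or>
        strict_antimono_on {1..k} t \<and> t 1 < t k + 2 * pi"
    and B: "\<And>j. j \<in> {1..k} \<Longrightarrow> B j - A = dist A (B j) *\<^sub>R polar_dir (t j)"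
    using assms(1) unfolding cyclically_ordered_def by blast
  obtain s where s: "s \<in> {1, -1 :: real}" "strict_mono_on {1..k} (\<lambda>j. s * t j)"
    "s * t k < s * t 1 + 2 * pi"
  proof (cases "strict_mono_on {1..k} t \<and> t k < t 1 + 2 * pi")
    case True
    then show ?thesis using that[of 1] by simp
  next
    case False
    then show ?thesis using t that[of "-1"] by (auto simp: monotone_on_def)
  qed
  have cr: "s * cross2 (B j - A) (B m - A) > 0 \<longleftrightarrow> sin (s * t m - s * t j) > 0"
    if "j \<in> {1..k}" "m \<in> {1..k}" for j m
  proof -
    have "s * cross2 (B j - A) (B m - A) = dist A (B j) * dist A (B m) * (s * sin (t m - t j))"
      unfolding B[OF that(1)] B[OF that(2)] cross2_polar by simp
    also have "s * sin (t m - t j) = sin (s * t m - s * t j)"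
      using s(1) sin_minus[of "t m - t j"] by (auto simp del: sin_minus)
    finally have "s * cross2 (B j - A) (B m - A)
        = (dist A (B j) * dist A (B m)) * sin (s * t m - s * t j)" .
    moreover have "dist A (B j) * dist A (B m) > 0"
      using assms(2)[OF that(1)] assms(2)[OF that(2)] by simp
    ultimately show ?thesis by (metis mult_pos_pos zero_less_mult_pos)
  qed
  show ?thesis
  proof (rule that)
    show "s \<noteq> 0" using s(1) by auto
  next
    fix j m
    assume jm: "j \<in> {1..k}" "m \<in> {1..k}" "s * cross2 (B j - A) (B m - A) > 0"
      and gap: "\<And>l. l \<in> {1..k} \<Longrightarrow>
        \<not> (s * cross2 (B j - A) (B l - A) > 0 \<and> s * cross2 (B l - A) (B m - A) > 0)"
    show "m = cyc_succ k j"
    proof (rule next_angle_is_cyc_succ[OF s(2,3) jm(1,2)])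
      show "0 < sin (s * t m - s * t j)" using cr jm by blast
      show "\<not> (0 < sin (s * t l - s * t j) \<and> 0 < sin (s * t m - s * t l))" if "l \<in> {1..k}" for l
        using gap[OF that] cr jm that by blast
    qed
  qed
qed

lemma consecutive_neighbours_meet:
  assumes "finite S" "A \<in> S" "bounded (voronoi_cell S A)" "non_degenerate S A"
    and "bij_betw B {1..k} (neighbours S A)" "cyclically_ordered A k B" "j \<in> {1..k}"
  obtains v where "cyc_succ k j \<in> {1..k}" "sites_at S v = {A, B j, B (cyc_succ k j)}"
    "B j \<noteq> B (cyc_succ k j)"
proof -
  have nb: "B j \<in> S" "adjacent S A (B j)" "B j \<noteq> A" if "j \<in> {1..k}" for j
    using bij_betwE[OF assms(5)] that by (auto simp: neighbours_def adjacent_def)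
  obtain s :: real where s: "s \<noteq> 0"
    "\<And>j m. \<lbrakk>j \<in> {1..k}; m \<in> {1..k}; s * cross2 (B j - A) (B m - A) > 0;
      \<And>l. l \<in> {1..k} \<Longrightarrow>
        \<not> (s * cross2 (B j - A) (B l - A) > 0 \<and> s * cross2 (B l - A) (B m - A) > 0)\<rbrakk>
      \<Longrightarrow> m = cyc_succ k j"
    using cyclically_ordered_succ[OF assms(6)] nb(3) by metis
  obtain v Q where Q: "sites_at S v = {A, B j, Q}" "Q \<noteq> A" "Q \<noteq> B j"
    "s * cross2 (B j - A) (Q - A) > 0"
    using ridge_end[OF assms(1,2) nb(1)[OF assms(7)] assms(3,4) nb(2)[OF assms(7)] s(1)] .
  have "sites_at S v = {B j, A, Q}" using Q(1) by auto
  then have "adjacent S A Q" using adjacent_if_three_sites[OF assms(1)] Q(2) by blast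
  moreover have "Q \<in> S" using Q(1) by (auto simp: sites_at_def)
  ultimately have "Q \<in> neighbours S A" by (simp add: neighbours_def)
  then obtain m where m: "m \<in> {1..k}" "Q = B m"
    using bij_betw_imp_surj_on[OF assms(5)] by blast
  have "m = cyc_succ k j"
  proof (rule s(2)[OF assms(7) m(1)])
    show "s * cross2 (B j - A) (B m - A) > 0" using Q(4) m(2) by simp
    show "\<not> (s * cross2 (B j - A) (B l - A) > 0 \<and> s * cross2 (B l - A) (B m - A) > 0)"
      if "l \<in> {1..k}" for l
      using no_neighbour_between[OF Q(1) assms(2) nb(1)[OF that] nb(2)[OF that] Q(4)] m(2) by simp
  qed
  then show ?thesis using that[of v] m Q by simp
qed

section \<open>The homogeneous system\<close>

text \<open>From \<open>A\<close> to \<open>P\<close> directly takes one reflection, via \<open>Q\<close> it takes two, and each of them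
  negates \<open>cross2\<close>.\<close>

lemma cross2_vertex_eq_0:
  assumes "finite S" "sites_at S v = {A, P, Q}" "P \<noteq> Q" "P \<noteq> A" "Q \<noteq> A"
    and "bounded (voronoi_cell S A)" "bounded (voronoi_cell S P)"
    and "p = ridge_refl S A P *v h" "q = ridge_refl S A Q *v h" "p = ridge_refl S P Q *v q"
  shows "cross2 h (A - v) = 0"
proof -
  have perms: "sites_at S v = {Q, A, P}" "sites_at S v = {P, A, Q}" using assms(2) by auto
  have adj: "adjacent S A P" "adjacent S A Q" "adjacent S P Q"
    using adjacent_if_three_sites[OF assms(1)] assms(2-5) perms by metis+
  have S: "A \<in> S" "P \<in> S" "Q \<in> S" using assms(2) by (auto simp: sites_at_def)
  have v: "v \<in> ridge S A P" "v \<in> ridge S A Q" "v \<in> ridge S P Q"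
    using assms(2) by (auto simp: sites_at_def ridge_def)
  note AP = S(1,2) assms(6) adj(1) and AQ = S(1,3) assms(6) adj(2) and PQ = S(2,3) assms(7) adj(3)
  have "cross2 p (P - v) = - cross2 h (A - v)"
    using cross2_ridge_refl[OF AP, of h "A - v"] ridge_refl_swaps(1)[OF AP v(1)] assms(8) by simp
  moreover have "cross2 q (Q - v) = - cross2 h (A - v)"
    using cross2_ridge_refl[OF AQ, of h "A - v"] ridge_refl_swaps(1)[OF AQ v(2)] assms(9) by simp
  moreover have "cross2 p (P - v) = - cross2 q (Q - v)"
    using cross2_ridge_refl[OF PQ, of q "Q - v"] ridge_refl_swaps(2)[OF PQ v(3)] assms(10) by simp
  ultimately show ?thesis by simp
qed

lemma vertices_in_distinct_directions:
  assumes "sites_at S v = {A, P, Q}" "sites_at S w = {A, Q, R}" "Q \<noteq> A" "P \<noteq> A" "P \<noteq> Q" "P \<noteq> R"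
    and "cross2 h (A - v) = 0" "cross2 h (A - w) = 0"
  shows "h = 0"
proof (rule ccontr)
  assume "h \<noteq> 0"
  obtain c where c: "A - v = c *\<^sub>R h" using parallel_if_cross2_eq_0[OF assms(7) \<open>h \<noteq> 0\<close>] .
  obtain d where d: "A - w = d *\<^sub>R h" using parallel_if_cross2_eq_0[OF assms(8) \<open>h \<noteq> 0\<close>] .
  \<comment> \<open>The right-hand side is nonzero and does not depend on the point \<open>x\<close> of the bisector.\<close>
  have bis: "2 * ((Q - A) \<bullet> (A - x)) = - ((Q - A) \<bullet> (Q - A))"
    if "dist x A = dist x Q" for x
    using that by (simp add: dist_eq_iff_inner inner_diff inner_commute[of A Q] algebra_simps)
  have "dist v A = dist v Q" "dist w A = dist w Q"
    using sites_at_equidistant[of A S v Q] sites_at_equidistant[of A S w Q] assms(1,2) by simp_all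
  then have "2 * (c * ((Q - A) \<bullet> h)) = - ((Q - A) \<bullet> (Q - A))"
    "2 * (d * ((Q - A) \<bullet> h)) = - ((Q - A) \<bullet> (Q - A))"
    using bis[of v] bis[of w] c d by simp_all
  moreover from this have "(Q - A) \<bullet> h \<noteq> 0" using assms(3) by auto
  ultimately have "c * ((Q - A) \<bullet> h) = d * ((Q - A) \<bullet> h)" by linarith
  with \<open>(Q - A) \<bullet> h \<noteq> 0\<close> have "c = d" by simp
  then have "A - v = A - w" using c d by simp
  then have "v = w" by simp
  then show False using assms(1,2,4-6) by auto
qed

theorem mainTheorem1:
  fixes S :: "(real ^ 2) set" and A :: "real ^ 2" and B :: "nat \<Rightarrow> real ^ 2" and k :: nat
  assumes "finite S" and "A \<in> S"
    and "bounded (voronoi_cell S A)"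
    and "strictly_interior S A"
    and "non_degenerate S A"
    and "k \<ge> 3"
    and "bij_betw B {1..k} (neighbours S A)"
    and "cyclically_ordered A k B"
    and "\<forall>j\<in>{1..k}. bounded (voronoi_cell S (B j))"
    and "\<exists>i\<in>{1..k}. \<exists>j\<in>{1..k}. \<not> collinear {0, ridge_dir S A (B i), ridge_dir S A (B j)}"
  shows "\<exists>!g :: nat \<Rightarrow> real ^ 2. g \<in> {0..k} \<rightarrow>\<^sub>E UNIV \<and>
    (\<forall>j\<in>{1..k}.
       g j - ridge_refl S A (B j) *v g 0 = (mat 1 - ridge_refl S A (B j)) *v ridge_mid S A (B j)) \<and>
    (\<forall>x\<in>{1..k}. let y = cyc_succ k x in
       g x - ridge_refl S (B x) (B y) *v g y
         = (mat 1 - ridge_refl S (B x) (B y)) *v ridge_mid S (B x) (B y))"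
proof -
  note anchor = \<open>finite S\<close> \<open>A \<in> S\<close> \<open>bounded (voronoi_cell S A)\<close>
  note bdA = anchor(3)
  have nb: "B j \<in> S" "adjacent S A (B j)" "B j \<noteq> A" "bounded (voronoi_cell S (B j))"
    if "j \<in> {1..k}" for j
    using bij_betwE[OF assms(7)] assms(9) that by (auto simp: neighbours_def adjacent_def)
  have meet: "\<exists>v. cyc_succ k j \<in> {1..k} \<and> sites_at S v = {A, B j, B (cyc_succ k j)}
      \<and> B j \<noteq> B (cyc_succ k j)" if "j \<in> {1..k}" for j
    using consecutive_neighbours_meet[OF anchor assms(5,7,8) that] by metis
  have adj: "adjacent S (B j) (B (cyc_succ k j))" if "j \<in> {1..k}" for j
    using meet[OF that] adjacent_if_three_sites[OF anchor(1)] by blast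
  show ?thesis
  proof (rule ex_ex1I, goal_cases)
    case 1
    define g where "g = restrict (\<lambda>j. if j = 0 then A else B j) {0..k}"
    have g: "g 0 = A" "\<And>j. j \<in> {1..k} \<Longrightarrow> g j = B j" by (auto simp: g_def)
    show ?case
    proof (intro exI[of _ g] conjI ballI)
      show "g \<in> {0..k} \<rightarrow>\<^sub>E UNIV" by (simp add: g_def)
    next
      fix j assume j: "j \<in> {1..k}"
      show "g j - ridge_refl S A (B j) *v g 0
          = (mat 1 - ridge_refl S A (B j)) *v ridge_mid S A (B j)"
        using ridge_equation(2)[OF anchor(2) nb(1)[OF j] bdA nb(2)[OF j]] g j by simp
    next
      fix j assume j: "j \<in> {1..k}"
      then have "cyc_succ k j \<in> {1..k}" using meet by blast
      then show "let y = cyc_succ k j in g j - ridge_refl S (B j) (B y) *v g y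
          = (mat 1 - ridge_refl S (B j) (B y)) *v ridge_mid S (B j) (B y)"
        using ridge_equation(1)[OF nb(1)[OF j] nb(1) nb(4)[OF j] adj[OF j]] g j by (simp add: Let_def)
    qed
  next
    case (2 g g')
    define h where "h j = g j - g' j" for j
    have spoke: "h j = ridge_refl S A (B j) *v h 0" if "j \<in> {1..k}" for j
    proof -
      have "g j - ridge_refl S A (B j) *v g 0 = g' j - ridge_refl S A (B j) *v g' 0"
        using 2 that by simp
      then show ?thesis
        by (simp add: h_def matrix_vector_mult_diff_distrib algebra_simps)
    qed
    have rim: "h j = ridge_refl S (B j) (B (cyc_succ k j)) *v h (cyc_succ k j)"
      if "j \<in> {1..k}" for j
    proof -
      have "g j - ridge_refl S (B j) (B (cyc_succ k j)) *v g (cyc_succ k j)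
          = g' j - ridge_refl S (B j) (B (cyc_succ k j)) *v g' (cyc_succ k j)"
        using 2 that by (simp add: Let_def)
      then show ?thesis
        by (simp add: h_def matrix_vector_mult_diff_distrib algebra_simps)
    qed
    have vertex: "\<exists>v. sites_at S v = {A, B j, B (cyc_succ k j)} \<and> cross2 (h 0) (A - v) = 0"
      if j: "j \<in> {1..k}" for j
    proof -
      obtain v where v: "cyc_succ k j \<in> {1..k}" "sites_at S v = {A, B j, B (cyc_succ k j)}"
        "B j \<noteq> B (cyc_succ k j)"
        using meet[OF j] by blast
      have "cross2 (h 0) (A - v) = 0"
        using cross2_vertex_eq_0[OF anchor(1) v(2,3) nb(3)[OF j] nb(3)[OF v(1)] bdA nb(4)[OF j]
            spoke[OF j] spoke[OF v(1)] rim[OF j]] .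
      with v(2) show ?thesis by blast
    qed
    have succ: "cyc_succ k 1 = 2" "cyc_succ k 2 = 3" using \<open>k \<ge> 3\<close> by (simp_all add: cyc_succ_def)
    have in_k: "1 \<in> {1..k}" "2 \<in> {1..k}" "3 \<in> {1..k}" using \<open>k \<ge> 3\<close> by simp_all
    obtain v where v: "sites_at S v = {A, B 1, B 2}" "cross2 (h 0) (A - v) = 0"
      using vertex[OF in_k(1)] succ by auto
    obtain w where w: "sites_at S w = {A, B 2, B 3}" "cross2 (h 0) (A - w) = 0"
      using vertex[OF in_k(2)] succ by auto
    have inj: "inj_on B {1..k}" using assms(7) by (rule bij_betw_imp_inj_on)
    have "B 1 \<noteq> B 2" "B 1 \<noteq> B 3" using inj_onD[OF inj _ in_k(1)] in_k by fastforce+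
    then have "h 0 = 0"
      using vertices_in_distinct_directions[OF v(1) w(1) _ _ _ _ v(2) w(2)] nb(3) in_k by blast
    then have "h j = 0" if "j \<in> {0..k}" for j
      using spoke[of j] that by (cases "j = 0") auto
    then show "g = g'"
      using 2 by (intro PiE_ext[of g "{0..k}" _ g']) (auto simp: h_def)
  qed
qed

end
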